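(* Let $K<\infty$ and $c<1$. If an AMS measure $\nu$ on $(\mathbb{Y}^{\mathbb{Z}},\mathcal{Y}^{\mathbb{Z}})$ has $(K,c)$-energy, then so does its stationary mean $\bar\nu$.
   Context: $\mathbb{Y}$ is a countable alphabet, $\mathbb{Y}^*$ the set of finite strings over it (including the empty one), $|u|$ string length; $(\mathbb{Y}^{\mathbb{Z}},\mathcal{Y}^{\mathbb{Z}})$ is the space of two-sided sequences with product $\sigma$-algebra; "measure" means probability measure; $T((y_i)_{i\in\mathbb{Z}})=(y_{i+1})_{i\in\mathbb{Z}}$ is the shift. A measure $\nu$ is asymptotically mean stationary (AMS) if $\bar\nu(A)=\lim_{n\to\infty}\frac1n\sum_{i=0}^{n-1}\nu(T^{-i}A)$ exists for every measurable $A$; $\bar\nu$ is then a stationary probability measure called the stationary mean of $\nu$. The cylinder of $u\in\mathbb{Y}^*$ is $[u]=\{y^{\mathbb{Z}}:y_1\dots y_{|u|}=u\}$. A measure $\nu$ has $(K,c)$-energy (where $c<1$, $K<\infty$) if $\nu([uv])\le Kc^{|v|}\nu([u])$ for all $u,v\in\mathbb{Y}^*$. *)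

theory Defs
  imports "HOL-Probability.Probability"
begin

text \<open>The alphabet is a type of class \<open>countable\<close> carrying the discrete \<open>\<sigma>\<close>-algebra.\<close>

definition seq_space :: "(int \<Rightarrow> 'y::countable) measure" where
  "seq_space = (\<Pi>\<^sub>M i\<in>UNIV. count_space UNIV)"

definition shift :: "(int \<Rightarrow> 'y) \<Rightarrow> (int \<Rightarrow> 'y)" where
  "shift y = (\<lambda>i. y (i + 1))"

text \<open>The value at \<open>n = 0\<close> is the irrelevant \<open>0 / 0 = 0\<close>.\<close>

definition cesaro_mean :: "(int \<Rightarrow> 'y) measure \<Rightarrow> nat \<Rightarrow> (int \<Rightarrow> 'y) set \<Rightarrow> real" where
  "cesaro_mean \<nu> n A = (\<Sum>i<n. measure \<nu> ((shift ^^ i) -` A)) / real n"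

definition ams :: "(int \<Rightarrow> 'y) measure \<Rightarrow> bool" where
  "ams \<nu> \<longleftrightarrow> (\<forall>A\<in>sets \<nu>. convergent (\<lambda>n. cesaro_mean \<nu> n A))"

text \<open>
  By the Vitali-Hahn-Saks theorem the limit is countably additive when \<open>\<nu>\<close> is an AMS probability
  measure, so that \<open>measure_of\<close> does not return its default value; see the lemmas
  \<open>cesaro_mean_tendsto_stationary_mean\<close> and \<open>prob_space_stationary_mean\<close> below.
\<close>

definition stationary_mean :: "(int \<Rightarrow> 'y) measure \<Rightarrow> (int \<Rightarrow> 'y) measure" where
  "stationary_mean \<nu> = measure_of (space \<nu>) (sets \<nu>) (\<lambda>A. ennreal (lim (\<lambda>n. cesaro_mean \<nu> n A)))"

definition cylinder :: "'y list \<Rightarrow> (int \<Rightarrow> 'y) set" where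
  "cylinder u = {y. map y [1..int (length u)] = u}"

definition has_energy :: "real \<Rightarrow> real \<Rightarrow> (int \<Rightarrow> 'y) measure \<Rightarrow> bool" where
  "has_energy K c \<nu> \<longleftrightarrow>
    (\<forall>u v. measure \<nu> (cylinder (u @ v)) \<le> K * c ^ length v * measure \<nu> (cylinder u))"


subsection \<open>The stationary mean is a probability measure\<close>

lemma space_seq_space [simp]: "space seq_space = UNIV"
  by (simp add: seq_space_def space_PiM)

lemma measurable_shift [measurable]: "shift \<in> measurable seq_space seq_space"
  unfolding seq_space_def shift_def
  by (rule measurable_PiM_single') (auto simp: space_PiM)

lemma measurable_shift_funpow: "shift ^^ i \<in> measurable seq_space seq_space"
proof (induction i)
  case (Suc i)
  then show ?case
    using measurable_comp[OF Suc measurable_shift] by simp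
qed auto

lemma sliding_hump:
  fixes p :: "nat \<Rightarrow> nat set \<Rightarrow> real" and q :: "nat set \<Rightarrow> real"
  assumes nn: "\<And>n E. 0 \<le> p n E"
    and add: "\<And>n E F. E \<inter> F = {} \<Longrightarrow> p n (E \<union> F) = p n E + p n F"
    and tail: "\<And>n. (\<lambda>m. p n {m..}) \<longlonglongrightarrow> 0"
    and lim: "\<And>E. (\<lambda>n. p n E) \<longlonglongrightarrow> q E"
  shows "(\<lambda>m. q {m..}) \<longlonglongrightarrow> 0"
proof -
  have qnn: "0 \<le> q E" for E
    by (rule LIMSEQ_le_const[OF lim]) (use nn in auto)
  have qadd: "q (E \<union> F) = q E + q F" if "E \<inter> F = {}" for E F
    using LIMSEQ_unique[OF lim[of "E \<union> F"]] tendsto_add[OF lim[of E] lim[of F]] add[OF that]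
    by simp
  have pmono: "p n E \<le> p n F" if "E \<subseteq> F" for n E F
    using add[of E "F - E" n] nn[of n "F - E"] that by (simp add: Un_absorb1)
  have qmono: "q E \<le> q F" if "E \<subseteq> F" for E F
    using qadd[of E "F - E"] qnn[of "F - E"] that by (simp add: Un_absorb1)
  have dec: "decseq (\<lambda>m. q {m..})"
    by (auto simp: decseq_def intro: qmono)
  obtain d where d: "(\<lambda>m. q {m..}) \<longlonglongrightarrow> d" and dle: "\<And>m. d \<le> q {m..}"
    using decseq_convergent[OF dec, of 0] qnn by metis
  have d0: "0 \<le> d"
    by (rule LIMSEQ_le_const[OF d]) (use qnn in auto)
  have "d = 0"
  proof (rule ccontr)
    assume "d \<noteq> 0"
    define e where "e = d / 8"
    have e: "e > 0" "d = 8 * e" using d0 \<open>d \<noteq> 0\<close> by (auto simp: e_def)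
    define R where "R = (\<lambda>(m::nat, n::nat) (m', n').
      m < m' \<and> n < n' \<and> (\<forall>F. F \<subseteq> {..<m} \<longrightarrow> \<bar>p n' F - q F\<bar> < e) \<and>
      p n' {m..} > d - e \<and> p n' {m'..} < e)"
    have "\<exists>t. R s t" for s
    proof -
      obtain m n where s: "s = (m, n)" by (cases s)
      have "\<forall>\<^sub>F k in sequentially. \<forall>F\<in>Pow {..<m}. \<bar>p k F - q F\<bar> < e"
        by (rule eventually_ball_finite)
          (use lim e in \<open>auto simp: tendsto_iff dist_real_def\<close>)
      moreover have "\<forall>\<^sub>F k in sequentially. p k {m..} > d - e"
        by (rule order_tendstoD(1)[OF lim]) (use dle[of m] e in auto)
      moreover have "\<forall>\<^sub>F k in sequentially. n < k"
        by (rule eventually_gt_at_top)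
      ultimately have "\<forall>\<^sub>F k in sequentially. (\<forall>F\<in>Pow {..<m}. \<bar>p k F - q F\<bar> < e) \<and>
          p k {m..} > d - e \<and> n < k"
        by eventually_elim auto
      then obtain k where k: "\<forall>F\<in>Pow {..<m}. \<bar>p k F - q F\<bar> < e" "p k {m..} > d - e" "n < k"
        by (auto simp: eventually_sequentially)
      have "\<forall>\<^sub>F m' in sequentially. p k {m'..} < e"
        by (rule order_tendstoD(2)[OF tail]) (use e in auto)
      then have "\<forall>\<^sub>F m' in sequentially. p k {m'..} < e \<and> m < m'"
        using eventually_gt_at_top[of m] by eventually_elim auto
      then obtain m' where "p k {m'..} < e" "m < m'"
        by (auto simp: eventually_sequentially)
      then have "R s (m', k)"
        using k by (auto simp: R_def s)
      then show ?thesis ..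
    qed
    then obtain g where g: "\<And>s. R s (g s)" by metis
    define s where "s = (\<lambda>j. (g ^^ j) (0, 0))"
    define m where "m = (\<lambda>j. fst (s j))"
    define n where "n = (\<lambda>j. snd (s (Suc j)))"
    have Rs: "R (s j) (s (Suc j))" for j
      using g[of "s j"] by (simp add: s_def)
    have Rs': "m j < m (Suc j)" "\<And>F. F \<subseteq> {..<m j} \<Longrightarrow> \<bar>p (n j) F - q F\<bar> < e"
      "p (n j) {m j..} > d - e" "p (n j) {m (Suc j)..} < e" for j
      using Rs[of j] by (auto simp: R_def m_def n_def split: prod.splits)
    have nS: "n j < n (Suc j)" for j
      using Rs[of "Suc j"] by (auto simp: R_def m_def n_def split: prod.splits)
    have ms: "strict_mono m" and ns: "strict_mono n"
      using Rs'(1) nS by (auto simp: strict_mono_Suc_iff)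
    define E where "E = (\<Union>j\<in>{j. even j}. {m j..<m (Suc j)})"
    have block: "x \<in> E \<longleftrightarrow> even j" if x: "m j \<le> x" "x < m (Suc j)" for x j
    proof -
      have uniq: "i = j" if "m i \<le> x" "x < m (Suc i)" for i
      proof -
        have "m i < m (Suc j)" "m j < m (Suc i)" using x that by linarith+
        then have "i < Suc j" "j < Suc i" using strict_mono_less[OF ms] by blast+
        then show ?thesis by simp
      qed
      show ?thesis
      proof
        assume "x \<in> E"
        then obtain i where i: "even i" "m i \<le> x" "x < m (Suc i)" by (auto simp: E_def)
        then show "even j" using uniq[OF i(2,3)] by simp
      next
        assume "even j"
        then show "x \<in> E" using x unfolding E_def by (intro UN_I[of j]) auto
      qed
    qed
    have split: "p (n j) E = p (n j) (E \<inter> {..<m j}) + p (n j) (E \<inter> {m j..<m (Suc j)})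
        + p (n j) (E \<inter> {m (Suc j)..})" for j
    proof -
      have "E = (E \<inter> {..<m j} \<union> E \<inter> {m j..<m (Suc j)}) \<union> E \<inter> {m (Suc j)..}"
        using Rs'(1)[of j] by auto
      moreover have "p (n j) ((E \<inter> {..<m j} \<union> E \<inter> {m j..<m (Suc j)}) \<union> E \<inter> {m (Suc j)..}) =
         p (n j) (E \<inter> {..<m j} \<union> E \<inter> {m j..<m (Suc j)}) + p (n j) (E \<inter> {m (Suc j)..})"
        using Rs'(1)[of j] by (intro add) auto
      moreover have "p (n j) (E \<inter> {..<m j} \<union> E \<inter> {m j..<m (Suc j)}) =
         p (n j) (E \<inter> {..<m j}) + p (n j) (E \<inter> {m j..<m (Suc j)})"
        by (intro add) auto
      ultimately show ?thesis by simp
    qed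
    define r where "r = (\<lambda>j. p (n j) E - q (E \<inter> {..<m j}))"
    have inc: "incseq (\<lambda>j. q (E \<inter> {..<m j}))"
    proof (rule incseq_SucI)
      show "q (E \<inter> {..<m j}) \<le> q (E \<inter> {..<m (Suc j)})" for j
        using Rs'(1)[of j] by (intro qmono) auto
    qed
    obtain L where L: "(\<lambda>j. q (E \<inter> {..<m j})) \<longlonglongrightarrow> L"
      using incseq_convergent[OF inc, of "q UNIV"] qmono by (metis subset_UNIV)
    have r: "r \<longlonglongrightarrow> q E - L"
      unfolding r_def
      using LIMSEQ_subseq_LIMSEQ[OF lim[of E] ns] L by (intro tendsto_diff) (auto simp: o_def)
    have ev: "r j \<ge> 5 * e" if "even j" for j
    proof -
      have "E \<inter> {m j..<m (Suc j)} = {m j..<m (Suc j)}" using block[of j] that by auto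
      moreover have "{m j..} = {m j..<m (Suc j)} \<union> {m (Suc j)..}" using Rs'(1)[of j] by auto
      moreover have "p (n j) ({m j..<m (Suc j)} \<union> {m (Suc j)..}) =
          p (n j) {m j..<m (Suc j)} + p (n j) {m (Suc j)..}"
        by (intro add) auto
      ultimately show ?thesis
        using split[of j] Rs'(2)[of "E \<inter> {..<m j}" j] Rs'(3,4)[of j]
          nn[of "n j" "E \<inter> {m (Suc j)..}"] e by (simp add: r_def)
    qed
    have od: "r j \<le> 2 * e" if "odd j" for j
    proof -
      have "E \<inter> {m j..<m (Suc j)} = {}" using block[of j] that by auto
      moreover have "p (n j) {} = 0" using add[of "{}" "{}" "n j"] by simp
      ultimately show ?thesis
        using split[of j] Rs'(2)[of "E \<inter> {..<m j}" j] Rs'(4)[of j]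
          pmono[of "E \<inter> {m (Suc j)..}" "{m (Suc j)..}" "n j"] by (simp add: r_def)
    qed
    have s0: "strict_mono (\<lambda>j::nat. 2 * j)" and s1: "strict_mono (\<lambda>j::nat. 2 * j + 1)"
      by (auto simp: strict_mono_def)
    have "5 * e \<le> q E - L"
      by (rule LIMSEQ_le_const[OF LIMSEQ_subseq_LIMSEQ[OF r s0]]) (use ev in auto)
    moreover have "q E - L \<le> 2 * e"
      by (rule LIMSEQ_le_const2[OF LIMSEQ_subseq_LIMSEQ[OF r s1]]) (use od in auto)
    ultimately show False using e by simp
  qed
  with d show ?thesis by simp
qed

context
  fixes \<nu> :: "(int \<Rightarrow> 'y::countable) measure"
  assumes prob: "prob_space \<nu>" and sets: "sets \<nu> = sets seq_space" and ams: "ams \<nu>"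
begin

lemma sets_vimage_shift: "A \<in> sets \<nu> \<Longrightarrow> (shift ^^ i) -` A \<in> sets \<nu>"
  using measurable_sets[OF measurable_shift_funpow, of A i] by (simp add: sets)

lemma cesaro_mean_lim:
  "A \<in> sets \<nu> \<Longrightarrow> (\<lambda>n. cesaro_mean \<nu> n A) \<longlonglongrightarrow> lim (\<lambda>n. cesaro_mean \<nu> n A)"
  using ams by (simp add: ams_def convergent_LIMSEQ_iff)

lemma cesaro_mean_Un:
  assumes "A \<in> sets \<nu>" "B \<in> sets \<nu>" "A \<inter> B = {}"
  shows "cesaro_mean \<nu> n (A \<union> B) = cesaro_mean \<nu> n A + cesaro_mean \<nu> n B"
proof -
  interpret prob_space \<nu> by (rule prob)
  have "measure \<nu> ((shift ^^ i) -` (A \<union> B)) =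
      measure \<nu> ((shift ^^ i) -` A) + measure \<nu> ((shift ^^ i) -` B)" for i
    unfolding vimage_Un
    by (rule finite_measure_Union) (use assms sets_vimage_shift in auto)
  then show ?thesis
    by (simp add: cesaro_mean_def sum.distrib add_divide_distrib)
qed

lemma cesaro_mean_tail:
  fixes A :: "nat \<Rightarrow> (int \<Rightarrow> 'y) set"
  assumes A: "range A \<subseteq> sets \<nu>" "disjoint_family A"
  shows "(\<lambda>m. cesaro_mean \<nu> n (\<Union>k\<in>{m..}. A k)) \<longlonglongrightarrow> 0"
proof -
  interpret prob_space \<nu> by (rule prob)
  have "(\<Inter>m. \<Union>k\<in>{m..}. A k) = {}"
  proof (rule ccontr)
    assume "(\<Inter>m. \<Union>k\<in>{m..}. A k) \<noteq> {}"
    then obtain x where x: "\<And>m. \<exists>k\<ge>m. x \<in> A k" by fastforce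
    then obtain k where "x \<in> A k" by blast
    moreover obtain l where "l \<ge> Suc k" "x \<in> A l" using x by blast
    ultimately show False using disjoint_family_onD[OF A(2), of k l] by auto
  qed
  then have "(\<Inter>m. (shift ^^ i) -` (\<Union>k\<in>{m..}. A k)) = {}" for i
    unfolding vimage_INT[symmetric] by simp
  moreover have "(\<lambda>m. measure \<nu> ((shift ^^ i) -` (\<Union>k\<in>{m..}. A k)))
      \<longlonglongrightarrow> measure \<nu> (\<Inter>m. (shift ^^ i) -` (\<Union>k\<in>{m..}. A k))" for i
  proof (rule finite_Lim_measure_decseq)
    have "(\<Union>k\<in>{m..}. A k) \<in> sets \<nu>" for m using A by auto
    then show "range (\<lambda>m. (shift ^^ i) -` (\<Union>k\<in>{m..}. A k)) \<subseteq> sets \<nu>"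
      using sets_vimage_shift by blast
    show "decseq (\<lambda>m. (shift ^^ i) -` (\<Union>k\<in>{m..}. A k))"
      by (fastforce simp: decseq_def)
  qed
  ultimately have "(\<lambda>m. measure \<nu> ((shift ^^ i) -` (\<Union>k\<in>{m..}. A k))) \<longlonglongrightarrow> 0" for i
    by simp
  then have "(\<lambda>m. (\<Sum>i<n. measure \<nu> ((shift ^^ i) -` (\<Union>k\<in>{m..}. A k))) / real n)
      \<longlonglongrightarrow> (\<Sum>i<n. 0) / real n"
    unfolding divide_inverse by (intro tendsto_mult_right tendsto_sum)
  then show ?thesis by (simp add: cesaro_mean_def)
qed

lemma cesaro_mean_nonneg: "0 \<le> cesaro_mean \<nu> n A"
  by (simp add: cesaro_mean_def sum_nonneg)

lemma lim_cesaro_mean_nonneg: "A \<in> sets \<nu> \<Longrightarrow> 0 \<le> lim (\<lambda>n. cesaro_mean \<nu> n A)"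
  by (rule LIMSEQ_le_const[OF cesaro_mean_lim]) (auto intro: cesaro_mean_nonneg)

lemma lim_cesaro_mean_Un:
  assumes "A \<in> sets \<nu>" "B \<in> sets \<nu>" "A \<inter> B = {}"
  shows "lim (\<lambda>n. cesaro_mean \<nu> n (A \<union> B)) =
    lim (\<lambda>n. cesaro_mean \<nu> n A) + lim (\<lambda>n. cesaro_mean \<nu> n B)"
  using tendsto_add[OF cesaro_mean_lim[OF assms(1)] cesaro_mean_lim[OF assms(2)]]
  by (intro limI) (simp add: cesaro_mean_Un[OF assms])

lemma lim_cesaro_mean_sums:
  fixes A :: "nat \<Rightarrow> (int \<Rightarrow> 'y) set"
  assumes A: "range A \<subseteq> sets \<nu>" "disjoint_family A"
  shows "(\<lambda>k. lim (\<lambda>n. cesaro_mean \<nu> n (A k))) sums lim (\<lambda>n. cesaro_mean \<nu> n (\<Union>k. A k))"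
proof -
  define q where "q E = lim (\<lambda>n. cesaro_mean \<nu> n (\<Union>k\<in>E. A k))" for E
  have U: "(\<Union>k\<in>E. A k) \<in> sets \<nu>" for E using A by auto
  have disj: "(\<Union>k\<in>E. A k) \<inter> (\<Union>k\<in>F. A k) = {}" if "E \<inter> F = {}" for E F
  proof -
    have "A k \<inter> A l = {}" if "k \<in> E" "l \<in> F" for k l
      using that \<open>E \<inter> F = {}\<close> by (intro disjoint_family_onD[OF A(2)]) auto
    then show ?thesis by blast
  qed
  have qadd: "q (E \<union> F) = q E + q F" if "E \<inter> F = {}" for E F
    using lim_cesaro_mean_Un[OF U U disj[OF that]] by (simp add: q_def UN_Un)
  have "(\<lambda>m. q {m..}) \<longlonglongrightarrow> 0"
  proof (rule sliding_hump[where p = "\<lambda>n E. cesaro_mean \<nu> n (\<Union>k\<in>E. A k)"])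
    show "cesaro_mean \<nu> n (\<Union>k\<in>E \<union> F. A k) =
        cesaro_mean \<nu> n (\<Union>k\<in>E. A k) + cesaro_mean \<nu> n (\<Union>k\<in>F. A k)"
      if "E \<inter> F = {}" for n E F
      using cesaro_mean_Un[OF U U disj[OF that]] by (simp add: UN_Un)
    show "(\<lambda>n. cesaro_mean \<nu> n (\<Union>k\<in>E. A k)) \<longlonglongrightarrow> q E" for E
      unfolding q_def by (rule cesaro_mean_lim[OF U])
  qed (use cesaro_mean_nonneg cesaro_mean_tail[OF A] in auto)
  then have "(\<lambda>m. q UNIV - q {m..}) \<longlonglongrightarrow> q UNIV - 0"
    by (intro tendsto_diff tendsto_const)
  moreover have "q UNIV - q {m..} = (\<Sum>k<m. q {k})" for m
  proof (induction m)
    case (Suc m)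
    have "{m} \<union> {Suc m..} = {m..}" by auto
    then have "q {m..} = q {m} + q {Suc m..}" using qadd[of "{m}" "{Suc m..}"] by simp
    with Suc show ?case by simp
  qed (simp add: atLeast_0)
  ultimately show ?thesis by (simp add: sums_def q_def)
qed

lemma emeasure_stationary_mean:
  assumes "A \<in> sets \<nu>"
  shows "emeasure (stationary_mean \<nu>) A = ennreal (lim (\<lambda>n. cesaro_mean \<nu> n A))"
proof (rule emeasure_measure_of[OF stationary_mean_def])
  show "sets \<nu> \<subseteq> Pow (space \<nu>)" by (rule sets.space_closed)
  show "A \<in> sets (stationary_mean \<nu>)" using assms by (simp add: stationary_mean_def)
  have "cesaro_mean \<nu> n {} = 0" for n by (simp add: cesaro_mean_def)
  then show "positive (sets (stationary_mean \<nu>)) (\<lambda>A. ennreal (lim (\<lambda>n. cesaro_mean \<nu> n A)))"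
    by (simp add: positive_def)
  show "countably_additive (sets (stationary_mean \<nu>))
      (\<lambda>A. ennreal (lim (\<lambda>n. cesaro_mean \<nu> n A)))"
  proof (rule countably_additiveI)
    fix A :: "nat \<Rightarrow> (int \<Rightarrow> 'y) set"
    assume "range A \<subseteq> sets (stationary_mean \<nu>)" and d: "disjoint_family A"
    then have r: "range A \<subseteq> sets \<nu>" by (simp add: stationary_mean_def)
    show "(\<Sum>i. ennreal (lim (\<lambda>n. cesaro_mean \<nu> n (A i)))) =
        ennreal (lim (\<lambda>n. cesaro_mean \<nu> n (\<Union>i. A i)))"
      using lim_cesaro_mean_sums[OF r d] r
      by (intro suminf_ennreal_eq) (auto intro: lim_cesaro_mean_nonneg)
  qed
qed

lemma cesaro_mean_tendsto_stationary_mean: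
  assumes "A \<in> sets \<nu>"
  shows "(\<lambda>n. cesaro_mean \<nu> n A) \<longlonglongrightarrow> measure (stationary_mean \<nu>) A"
  using cesaro_mean_lim[OF assms]
  by (simp add: measure_def emeasure_stationary_mean[OF assms] lim_cesaro_mean_nonneg[OF assms])

lemma prob_space_stationary_mean: "prob_space (stationary_mean \<nu>)"
proof
  interpret prob_space \<nu> by (rule prob)
  have sp: "space \<nu> = UNIV" using sets_eq_imp_space_eq[OF sets] by simp
  have "measure \<nu> UNIV = 1" using prob_space by (simp add: sp)
  then have "cesaro_mean \<nu> n UNIV = real n / real n" for n
    by (simp add: cesaro_mean_def)
  moreover have "(\<lambda>n. real n / real n) \<longlonglongrightarrow> 1"
    by (rule tendsto_eventually) (auto simp: eventually_sequentially intro!: exI[of _ 1])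
  ultimately have "lim (\<lambda>n. cesaro_mean \<nu> n UNIV) = 1" by (simp add: limI)
  moreover have "UNIV \<in> sets \<nu>" using sets.top[of \<nu>] by (simp add: sp)
  ultimately show "emeasure (stationary_mean \<nu>) (space (stationary_mean \<nu>)) = 1"
    using emeasure_stationary_mean[of UNIV] by (simp add: stationary_mean_def sp)
qed

end

end

theory Submission
  imports Defs
begin

text \<open>
  Energy survives forgetting the past. The event that \<open>u\<close> is read \<open>i\<close> places later than in
  \<open>cylinder u\<close> is the disjoint union, over the words \<open>w\<close> of length \<open>i\<close>, of the cylinders of
  \<open>w @ u\<close> (lemma \<open>vimage_funpow_shift_cylinder\<close>). There are countably many such words, and for
  each of them the energy bound compares the extension \<open>w @ u @ v\<close> with \<open>w @ u\<close>, with a factor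
  \<open>K * c ^ length v\<close> that does not depend on \<open>w\<close>. Summing over \<open>w\<close> gives the same bound, with
  the same constants, for every shifted copy of the measure
  (lemma \<open>has_energy_vimage_funpow_shift\<close>). The bound is linear in the measure, so it passes
  to the Cesaro means, and being a weak inequality it passes to their limit.
\<close>

lemma funpow_shift_apply: "(shift ^^ i) y k = y (k + int i)"
proof (induction i arbitrary: k)
  case (Suc i)
  have "(shift ^^ Suc i) y k = (shift ^^ i) y (k + 1)" by (simp add: shift_def)
  then show ?case by (simp add: Suc.IH add.assoc)
qed simp

lemma mem_cylinder_iff: "y \<in> cylinder u \<longleftrightarrow> (\<forall>k<length u. y (int k + 1) = u ! k)"
proof -
  have "map y [1..int (length u)] ! k = y (int k + 1)" if "k < length u" for k
    using that by (simp add: add.commute)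
  moreover have "map y [1..int (length u)] = u \<longleftrightarrow>
      (\<forall>k<length u. map y [1..int (length u)] ! k = u ! k)"
    by (subst list_eq_iff_nth_eq) (simp only: length_map length_upto, simp)
  ultimately show ?thesis unfolding cylinder_def by auto
qed

lemma cylinder_measurable: "cylinder u \<in> sets (seq_space :: (int \<Rightarrow> 'y::countable) measure)"
proof -
  have component: "(\<lambda>y. y j) \<in> measurable seq_space (count_space (UNIV :: 'y set))" for j
    unfolding seq_space_def by (rule measurable_component_singleton) simp
  have "{y \<in> space seq_space. \<forall>k\<in>{..<length u}. y (int k + 1) = u ! k} \<in> sets seq_space"
  proof (rule sets.sets_Collect_finite_All)
    show "{y \<in> space seq_space. y (int k + 1) = u ! k} \<in> sets seq_space" for k
      using measurable_sets[OF component, of "{u ! k}" "int k + 1"]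
      by (simp add: vimage_def)
  qed simp
  also have "{y \<in> space seq_space. \<forall>k\<in>{..<length u}. y (int k + 1) = u ! k} = cylinder u"
    by (auto simp: mem_cylinder_iff)
  finally show ?thesis .
qed

text \<open>Sort the sequences by the word \<open>w\<close> that they carry at the places \<open>1, \<dots>, i\<close>.\<close>

lemma vimage_funpow_shift_cylinder:
  "(shift ^^ i) -` cylinder u = (\<Union>w\<in>{w. length w = i}. cylinder (w @ u))"
proof (intro set_eqI iffI)
  fix y
  assume y: "y \<in> (shift ^^ i) -` cylinder u"
  define w where "w = map (\<lambda>k. y (int k + 1)) [0..<i]"
  have "y (int k + 1) = (w @ u) ! k" if "k < i + length u" for k
  proof (cases "k < i")
    case True
    then show ?thesis by (simp add: w_def nth_append)
  next
    case False
    then have "k - i < length u" using that by linarith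
    then have "y (int (k - i) + 1 + int i) = u ! (k - i)"
      using y unfolding vimage_eq mem_cylinder_iff funpow_shift_apply by blast
    moreover have "int (k - i) + 1 + int i = int k + 1" using False by simp
    ultimately show ?thesis using False by (simp add: w_def nth_append)
  qed
  then have "y \<in> cylinder (w @ u)" by (simp add: mem_cylinder_iff w_def)
  moreover have "length w = i" by (simp add: w_def)
  ultimately show "y \<in> (\<Union>w\<in>{w. length w = i}. cylinder (w @ u))" by blast
next
  fix y
  assume "y \<in> (\<Union>w\<in>{w. length w = i}. cylinder (w @ u))"
  then obtain w where w: "length w = i" "y \<in> cylinder (w @ u)" by auto
  have "y (int k + 1 + int i) = u ! k" if "k < length u" for k
  proof -
    have "i + k < length (w @ u)" using w(1) that by simp
    then have "y (int (i + k) + 1) = (w @ u) ! (i + k)"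
      using w(2) unfolding mem_cylinder_iff by blast
    then show ?thesis using w(1) by (simp add: nth_append add_ac)
  qed
  then show "y \<in> (shift ^^ i) -` cylinder u"
    by (simp add: mem_cylinder_iff funpow_shift_apply)
qed

lemma disjoint_family_cylinder_prefix:
  "disjoint_family_on (\<lambda>w. cylinder (w @ u)) {w. length w = i}"
  unfolding disjoint_family_on_def
proof (intro ballI impI)
  fix w w' :: "'a list"
  assume len: "w \<in> {w. length w = i}" "w' \<in> {w. length w = i}" and "w \<noteq> w'"
  then obtain k where k: "k < i" "w ! k \<noteq> w' ! k" by (auto simp: list_eq_iff_nth_eq)
  have "y (int k + 1) = v ! k" if "y \<in> cylinder (v @ u)" "length v = i" for y v
  proof -
    have "y (int k + 1) = (v @ u) ! k" using that k(1) by (simp add: mem_cylinder_iff)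
    then show ?thesis using that(2) k(1) by (simp add: nth_append)
  qed
  then show "cylinder (w @ u) \<inter> cylinder (w' @ u) = {}" using len k(2) by force
qed

lemma emeasure_vimage_funpow_shift_cylinder:
  fixes \<nu> :: "(int \<Rightarrow> 'y::countable) measure"
  assumes "sets \<nu> = sets seq_space"
  shows "emeasure \<nu> ((shift ^^ i) -` cylinder u) =
    (\<integral>\<^sup>+w. emeasure \<nu> (cylinder (w @ u)) \<partial>count_space {w. length w = i})"
  unfolding vimage_funpow_shift_cylinder
  by (rule emeasure_UN_countable)
    (auto simp: assms cylinder_measurable intro: disjoint_family_cylinder_prefix)

text \<open>
  Each word \<open>w\<close> of length \<open>i\<close> contributes the energy bound for the prefix \<open>w @ u\<close>. The sum over
  \<open>w\<close> is infinite when the alphabet is, so it is taken in \<open>ennreal\<close>, where convergence is no issue.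
\<close>

lemma has_energy_vimage_funpow_shift:
  fixes \<nu> :: "(int \<Rightarrow> 'y::countable) measure"
  assumes "prob_space \<nu>" and sets: "sets \<nu> = sets seq_space" and energy: "has_energy K c \<nu>"
  shows "measure \<nu> ((shift ^^ i) -` cylinder (u @ v)) \<le>
    K * c ^ length v * measure \<nu> ((shift ^^ i) -` cylinder u)"
proof -
  interpret prob_space \<nu> by fact
  let ?C = "K * c ^ length v"
  have "space \<nu> = UNIV" using sets_eq_imp_space_eq[OF sets] by simp
  then have "measure \<nu> (cylinder []) = 1" using prob_space by (simp add: cylinder_def)
  \<comment> \<open>The energy bound at the empty prefix forces the factor to be nonnegative, which is what
    allows it to be moved through \<open>ennreal\<close>.\<close>
  moreover have "measure \<nu> (cylinder ([] @ v)) \<le> ?C * measure \<nu> (cylinder [])"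
    using energy unfolding has_energy_def by blast
  ultimately have C: "0 \<le> ?C" by (simp add: order_trans[OF measure_nonneg])
  have prefix: "emeasure \<nu> (cylinder (w @ u @ v)) \<le> ennreal ?C * emeasure \<nu> (cylinder (w @ u))" for w
  proof -
    have "measure \<nu> (cylinder ((w @ u) @ v)) \<le> ?C * measure \<nu> (cylinder (w @ u))"
      using energy unfolding has_energy_def by blast
    then show ?thesis
      using C by (simp add: emeasure_eq_measure ennreal_mult[symmetric] ennreal_leI)
  qed
  have "emeasure \<nu> ((shift ^^ i) -` cylinder (u @ v)) =
      (\<integral>\<^sup>+w. emeasure \<nu> (cylinder (w @ u @ v)) \<partial>count_space {w. length w = i})"
    by (rule emeasure_vimage_funpow_shift_cylinder[OF sets])
  also have "\<dots> \<le> (\<integral>\<^sup>+w. ennreal ?C * emeasure \<nu> (cylinder (w @ u)) \<partial>count_space {w. length w = i})"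
    by (intro nn_integral_mono prefix)
  also have "\<dots> = ennreal ?C * emeasure \<nu> ((shift ^^ i) -` cylinder u)"
    by (simp add: nn_integral_cmult emeasure_vimage_funpow_shift_cylinder[OF sets])
  finally show ?thesis
    using C by (simp add: emeasure_eq_measure ennreal_mult[symmetric] ennreal_le_iff)
qed

theorem proposition5p8:
  fixes \<nu> :: "(int \<Rightarrow> 'y::countable) measure" and K c :: real
  assumes "c < 1"
    and "prob_space \<nu>" and "sets \<nu> = sets seq_space"
    and "ams \<nu>"
    and "has_energy K c \<nu>"
  shows "has_energy K c (stationary_mean \<nu>)"
  unfolding has_energy_def
proof (intro allI)
  fix u v :: "'y list"
  have lim: "(\<lambda>n. cesaro_mean \<nu> n (cylinder x))
      \<longlonglongrightarrow> measure (stationary_mean \<nu>) (cylinder x)" for x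
    by (rule cesaro_mean_tendsto_stationary_mean[OF assms(2-4)])
      (simp add: assms(3) cylinder_measurable)
  have mean: "cesaro_mean \<nu> n (cylinder (u @ v)) \<le>
      K * c ^ length v * cesaro_mean \<nu> n (cylinder u)" for n
    unfolding cesaro_mean_def times_divide_eq_right sum_distrib_left
    by (intro divide_right_mono sum_mono has_energy_vimage_funpow_shift assms(2,3,5)) simp
  show "measure (stationary_mean \<nu>) (cylinder (u @ v)) \<le>
      K * c ^ length v * measure (stationary_mean \<nu>) (cylinder u)"
    by (rule LIMSEQ_le[OF lim tendsto_mult_left[OF lim]]) (use mean in blast)
qed

end
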